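(* Let $\mathcal{H}$ be a real Hilbert space, $C\subset\mathcal{H}$ a nonempty, closed and convex set, and $f:\mathcal{H}\to\mathbb{R}$ a convex and Gateaux differentiable function such that the solution set $S_*$ of the problem $\min\{f(x) : x\in C\}$ is nonempty and such that $\nabla f$ is uniformly continuous on bounded sets. Assume that $\nabla f$ is bounded on bounded sets. Then any sequence $(x^k)_{k\in\mathbb{N}}$ generated by Algorithm A2 (with any $x^0\in C$, any $\theta,\delta\in(0,1)$ and any stepsizes $(\beta_k)_{k\in\mathbb N}\subset[\check\beta,\hat\beta]$ with $0<\check\beta\le\hat\beta<\infty$) converges strongly (in norm) to $x_*=P_{S_*}(x^0)$.
   Context: $\nabla f(x)\in\mathcal{H}$ denotes the Gateaux derivative of $f$ at $x$ (the directional derivative satisfies $f'(x;d)=\langle\nabla f(x),d\rangle$ for all $d\in\mathcal{H}$). $P_K$ is the metric projection onto a nonempty closed convex set $K$. $S_*=\{x\in C: f(x)\le f(y)\ \forall y\in C\}$. Here $\mathbb{N}=\{0,1,2,\dots\}$. "$\nabla f$ is uniformly continuous (resp. bounded) on bounded sets" means that for each bounded $B\subset\mathcal{H}$ the restriction of $\nabla f$ to $B$ is uniformly continuous (resp. $\nabla f(B)$ is bounded). Algorithm A2. Fix $\theta,\delta\in(0,1)$ and a sequence $(\beta_k)_{k\in\mathbb N}\subset[\check\beta,\hat\beta]$ with $0<\check\beta\le\hat\beta<\infty$. Take $x^0\in C$ and set $f^{lev}_{-1}=+\infty$. For $k=0,1,2,\dots$: given $x^k$, put $z^k=x^k-\beta_k\nabla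 f(x^k)$. If $x^k=P_C(z^k)$, stop. Otherwise let $$j(k)=\min\{j\in\mathbb{N} : f(x^{k,j})\le f(x^k)-\delta\theta^j\langle\nabla f(x^k),x^k-P_C(z^k)\rangle\},\qquad x^{k,j}=\theta^jP_C(z^k)+(1-\theta^j)x^k,$$ set $\alpha_k=\theta^{j(k)}$ and $f^{lev}_k=\min\{f^{lev}_{k-1},f(x^{k,j(k)})\}$, define $$H_k=\{x\in\mathcal{H}:\langle\nabla f(x^k),x-x^k\rangle+f(x^k)-f^{lev}_k\le0\},\qquad W_k=\{x\in\mathcal{H}:\langle x-x^k,x^0-x^k\rangle\le0\},$$ and set $x^{k+1}=P_{C\cap W_k\cap H_k}(x^0)$. If $x^{k+1}=x^k$, stop. "A sequence $(x^k)_{k\in\mathbb{N}}$ generated by Algorithm A2" means an infinite sequence, i.e. the algorithm does not stop. *)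

theory Defs
  imports "HOL-Analysis.Analysis"
begin

text \<open>A real Hilbert space is a type of sort \<open>{real_inner, banach}\<close>.\<close>

definition has_directional_derivative ::
    "('a::real_normed_vector \<Rightarrow> real) \<Rightarrow> 'a \<Rightarrow> 'a \<Rightarrow> real \<Rightarrow> bool" where
  "has_directional_derivative f x d l \<longleftrightarrow>
     ((\<lambda>t. (f (x + t *\<^sub>R d) - f x) / t) \<longlongrightarrow> l) (at_right 0)"

definition has_gateaux_gradient :: "('a::real_inner \<Rightarrow> real) \<Rightarrow> 'a \<Rightarrow> 'a \<Rightarrow> bool" where
  "has_gateaux_gradient f x g \<longleftrightarrow> (\<forall>d. has_directional_derivative f x d (g \<bullet> d))"

definition gateaux_differentiable :: "('a::real_inner \<Rightarrow> real) \<Rightarrow> bool" where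
  "gateaux_differentiable f \<longleftrightarrow> (\<forall>x. \<exists>g. has_gateaux_gradient f x g)"

definition gateaux_gradient :: "('a::real_inner \<Rightarrow> real) \<Rightarrow> 'a \<Rightarrow> 'a" where
  "gateaux_gradient f x = (THE g. has_gateaux_gradient f x g)"

lemma has_gateaux_gradient_unique:
  assumes "has_gateaux_gradient f x g" "has_gateaux_gradient f x h"
  shows "g = h"
proof -
  have "g \<bullet> d = h \<bullet> d" for d
    using assms tendsto_unique[OF trivial_limit_at_right_real]
    unfolding has_gateaux_gradient_def has_directional_derivative_def by blast
  then show ?thesis
    by (metis inner_commute vector_eq_rdot)
qed

lemma gateaux_gradient_eqI: "has_gateaux_gradient f x g \<Longrightarrow> gateaux_gradient f x = g"
  unfolding gateaux_gradient_def using has_gateaux_gradient_unique by blast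

text \<open>The library's \<open>closest_point\<close> needs the class \<open>heine_borel\<close>, which would force
  the space to be finite-dimensional.\<close>

definition metric_proj :: "'a::metric_space set \<Rightarrow> 'a \<Rightarrow> 'a" where
  "metric_proj K a = (THE p. p \<in> K \<and> (\<forall>y\<in>K. dist a p \<le> dist a y))"

definition solution_set :: "'a set \<Rightarrow> ('a \<Rightarrow> real) \<Rightarrow> 'a set" where
  "solution_set C f = {x \<in> C. \<forall>y\<in>C. f x \<le> f y}"

text \<open>In the following, \<open>b\<close> is the stepsize of one iteration, \<open>u\<close> its current
  iterate, and \<open>\<beta>\<close>, \<open>x\<close> are the whole sequences.\<close>

definition grad_proj :: "'a::real_inner set \<Rightarrow> ('a \<Rightarrow> real) \<Rightarrow> real \<Rightarrow> 'a \<Rightarrow> 'a" where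
  "grad_proj C f b u = metric_proj C (u - b *\<^sub>R gateaux_gradient f u)"

definition trial_point ::
    "'a::real_inner set \<Rightarrow> ('a \<Rightarrow> real) \<Rightarrow> real \<Rightarrow> real \<Rightarrow> 'a \<Rightarrow> nat \<Rightarrow> 'a" where
  "trial_point C f \<theta> b u j = \<theta> ^ j *\<^sub>R grad_proj C f b u + (1 - \<theta> ^ j) *\<^sub>R u"

definition search_index ::
    "'a::real_inner set \<Rightarrow> ('a \<Rightarrow> real) \<Rightarrow> real \<Rightarrow> real \<Rightarrow> real \<Rightarrow> 'a \<Rightarrow> nat" where
  "search_index C f \<theta> \<delta> b u =
     (LEAST j. f (trial_point C f \<theta> b u j)
        \<le> f u - \<delta> * \<theta> ^ j * (gateaux_gradient f u \<bullet> (u - grad_proj C f b u)))"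

text \<open>The index is shifted by one: \<open>flev \<dots> k\<close> is $f^{lev}_{k-1}$, so that
  \<open>flev \<dots> 0\<close> is $f^{lev}_{-1} = +\infty$.\<close>

primrec flev :: "'a::real_inner set \<Rightarrow> ('a \<Rightarrow> real) \<Rightarrow> real \<Rightarrow> real \<Rightarrow> (nat \<Rightarrow> real)
    \<Rightarrow> (nat \<Rightarrow> 'a) \<Rightarrow> nat \<Rightarrow> ereal" where
  "flev C f \<theta> \<delta> \<beta> x 0 = \<infinity>"
| "flev C f \<theta> \<delta> \<beta> x (Suc k) =
     min (flev C f \<theta> \<delta> \<beta> x k)
       (ereal (f (trial_point C f \<theta> (\<beta> k) (x k) (search_index C f \<theta> \<delta> (\<beta> k) (x k)))))"

definition H_set :: "'a::real_inner set \<Rightarrow> ('a \<Rightarrow> real) \<Rightarrow> real \<Rightarrow> real \<Rightarrow> (nat \<Rightarrow> real)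
    \<Rightarrow> (nat \<Rightarrow> 'a) \<Rightarrow> nat \<Rightarrow> 'a set" where
  "H_set C f \<theta> \<delta> \<beta> x k =
     {y. ereal (gateaux_gradient f (x k) \<bullet> (y - x k) + f (x k))
           - flev C f \<theta> \<delta> \<beta> x (Suc k) \<le> 0}"

definition W_set :: "(nat \<Rightarrow> 'a::real_inner) \<Rightarrow> nat \<Rightarrow> 'a set" where
  "W_set x k = {y. (y - x k) \<bullet> (x 0 - x k) \<le> 0}"

text \<open>The two disequalities say that neither stopping test of the algorithm ever fires.\<close>

definition generated_by_A2 :: "'a::real_inner set \<Rightarrow> ('a \<Rightarrow> real) \<Rightarrow> real \<Rightarrow> real
    \<Rightarrow> (nat \<Rightarrow> real) \<Rightarrow> (nat \<Rightarrow> 'a) \<Rightarrow> bool" where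
  "generated_by_A2 C f \<theta> \<delta> \<beta> x \<longleftrightarrow>
     x 0 \<in> C \<and>
     (\<forall>k. x k \<noteq> grad_proj C f (\<beta> k) (x k) \<and>
          x (Suc k) = metric_proj (C \<inter> W_set x k \<inter> H_set C f \<theta> \<delta> \<beta> x k) (x 0) \<and>
          x (Suc k) \<noteq> x k)"

end

theory Submission
  imports Defs
begin

text \<open>Every solution lies in all the sets $C \cap W_k \cap H_k$, so the distances from $x^0$ to the
  iterates increase and stay bounded, and the steps $x^{k+1} - x^k$ tend to $0$. Since
  $x^{k+1} \in H_k$, the decrease achieved by the line search tends to $0$ as well. Uniform continuity
  of the gradient bounds $\alpha_k$ from below as long as $\langle\nabla f(x^k), x^k - P_C(z^k)\rangle$
  does not become small, so this quantity tends to $0$ and $f(x^k)$ tends to the minimum. Thus the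
  iterates eventually enter each of the nested closed convex sets
  $\{y \in C : f(y) \le \min_C f + 1/(n+1)\}$, whose intersection is $S_*$. The distances from $x^0$ to these
  sets increase to the distance from $S_*$, and since $x_* \in W_k$ gives
  $\|x^k - x_*\|^2 \le \|x_* - x^0\|^2 - \|x^k - x^0\|^2$, this yields strong convergence.\<close>

section \<open>Projections in Hilbert space\<close>

text \<open>For n <= m the midpoint of \<open>y n\<close> and \<open>y m\<close> lies in the larger
  set \<open>K n\<close>, so the parallelogram law bounds their distance. A constant family yields
  existence of projections, a decreasing one convergence of the projections onto its
  members.\<close>

lemma nested_convex_minimizing_Cauchy:
  fixes K :: "nat \<Rightarrow> 'a::real_inner set"
  assumes dec: "decseq K" and conv: "\<And>n. convex (K n)" and y: "\<And>n. y n \<in> K n"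
    and lim: "(\<lambda>n. dist a (y n)) \<longlonglongrightarrow> d" and inf: "(\<lambda>n. infdist a (K n)) \<longlonglongrightarrow> d"
  shows "Cauchy y"
proof (rule metric_CauchyI)
  have key: "(dist (y n) (y m))\<^sup>2
      \<le> 2 * (dist a (y m))\<^sup>2 + 2 * (dist a (y n))\<^sup>2 - 4 * (infdist a (K n))\<^sup>2"
    if "n \<le> m" for m n
  proof -
    define c where "c = (1/2) *\<^sub>R y n + (1/2) *\<^sub>R y m"
    have "y m \<in> K n" using y[of m] decseqD[OF dec that] by blast
    then have "c \<in> K n" unfolding c_def using y[of n] conv[of n] by (intro convexD) auto
    then have "(infdist a (K n))\<^sup>2 \<le> (dist a c)\<^sup>2"
      by (intro power_mono infdist_le infdist_nonneg)
    moreover have "(dist (y n) (y m))\<^sup>2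
      = 2 * (dist a (y m))\<^sup>2 + 2 * (dist a (y n))\<^sup>2 - 4 * (dist a c)\<^sup>2"
      by (simp add: dist_norm power2_norm_eq_inner c_def inner_diff inner_add inner_commute
          algebra_simps)
    ultimately show ?thesis by simp
  qed
  fix e :: real assume "e > 0"
  have "(\<lambda>n. (dist a (y n))\<^sup>2 - (infdist a (K n))\<^sup>2) \<longlonglongrightarrow> d\<^sup>2 - d\<^sup>2"
    by (intro tendsto_intros lim inf)
  moreover have "e\<^sup>2 / 8 > 0" using \<open>e > 0\<close> by simp
  moreover have "(\<lambda>n. (dist a (y n))\<^sup>2) \<longlonglongrightarrow> d\<^sup>2" "(\<lambda>n. (infdist a (K n))\<^sup>2) \<longlonglongrightarrow> d\<^sup>2"
    by (intro tendsto_intros lim inf)+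
  \<comment> \<open>The three terms on the right of \<open>key\<close> then exceed their limits by
    less than e^2/4, e^2/4 and e^2/2, in total e^2.\<close>
  ultimately have "\<forall>\<^sub>F n in sequentially. (dist a (y n))\<^sup>2 < d\<^sup>2 + e\<^sup>2 / 8 
       \<and> d\<^sup>2 - e\<^sup>2 / 8 < (infdist a (K n))\<^sup>2"
    by (intro eventually_conj order_tendstoD) auto
  then obtain N where N: "\<And>n. n \<ge> N \<Longrightarrow> (dist a (y n))\<^sup>2 < d\<^sup>2 + e\<^sup>2 / 8"
      "\<And>n. n \<ge> N \<Longrightarrow> d\<^sup>2 - e\<^sup>2 / 8 < (infdist a (K n))\<^sup>2"
    unfolding eventually_sequentially by blast
  have close: "dist (y n) (y m) < e" if "N \<le> n" "n \<le> m" for m n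
  proof -
    have "(dist (y n) (y m))\<^sup>2 < e\<^sup>2"
      using key[OF that(2)] N[of n] N[of m] that by simp
    then show ?thesis using \<open>e > 0\<close> by (simp add: power2_less_imp_less)
  qed
  show "\<exists>M. \<forall>m\<ge>M. \<forall>n\<ge>M. dist (y m) (y n) < e"
    using close by (metis dist_commute nle_le)
qed

text \<open>Completeness takes the place of compactness: a minimizing sequence is Cauchy by the
  previous lemma, applied to the constant family.\<close>

lemma closest_point_exists_Hilbert:
  fixes K :: "'a::{real_inner, banach} set"
  assumes "closed K" "convex K" "K \<noteq> {}"
  shows "\<exists>p\<in>K. dist a p = infdist a K"
proof -
  have "\<exists>y\<in>K. dist a y < infdist a K + 1 / real (Suc n)" for n
    using infdist_notempty[OF assms(3), of a] cINF_less_iff[OF assms(3), of "dist a"]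
    by (metis bdd_below_image_dist less_add_same_cancel1 of_nat_0_less_iff zero_less_Suc
        zero_less_divide_1_iff)
  then obtain y where y: "\<And>n. y n \<in> K" "\<And>n. dist a (y n) < infdist a K + 1 / real (Suc n)"
    by metis
  have lim: "(\<lambda>n. dist a (y n)) \<longlonglongrightarrow> infdist a K"
  proof (rule tendsto_sandwich[OF _ _ tendsto_const])
    show "(\<lambda>n. infdist a K + 1 / real (Suc n)) \<longlonglongrightarrow> infdist a K"
      using tendsto_add[OF tendsto_const LIMSEQ_Suc[OF lim_1_over_n]] by fastforce
    show "\<forall>\<^sub>F n in sequentially. infdist a K \<le> dist a (y n)"
      using infdist_le[OF y(1)] by simp
    show "\<forall>\<^sub>F n in sequentially. dist a (y n) \<le> infdist a K + 1 / real (Suc n)"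
      by (intro always_eventually allI less_imp_le y(2))
  qed
  have "Cauchy y"
    by (rule nested_convex_minimizing_Cauchy[where K = "\<lambda>_. K", OF _ _ _ lim])
      (use assms y in \<open>auto simp: decseq_def\<close>)
  then obtain p where p: "y \<longlonglongrightarrow> p" using Cauchy_convergent convergent_def by blast
  have "p \<in> K" using closed_sequentially[OF assms(1) _ p] y(1) by blast
  moreover have "dist a p = infdist a K"
    by (rule LIMSEQ_unique[OF tendsto_dist[OF tendsto_const p] lim])
  ultimately show ?thesis by blast
qed

context
  fixes K :: "'a::{real_inner, banach} set"
  assumes K: "closed K" "convex K" "K \<noteq> {}"
begin

lemma metric_proj_closest:
  "metric_proj K a \<in> K \<and> (\<forall>y\<in>K. dist a (metric_proj K a) \<le> dist a y)"
  unfolding metric_proj_def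
proof (rule theI')
  obtain p where "p \<in> K" "dist a p = infdist a K"
    using closest_point_exists_Hilbert[OF K] by blast
  then have "p \<in> K \<and> (\<forall>y\<in>K. dist a p \<le> dist a y)" by (simp add: infdist_le)
  then show "\<exists>!p. p \<in> K \<and> (\<forall>y\<in>K. dist a p \<le> dist a y)"
    using any_closest_point_unique[OF K(2,1)] by blast
qed

lemma metric_proj_in: "metric_proj K a \<in> K"
  and dist_metric_proj_le: "y \<in> K \<Longrightarrow> dist a (metric_proj K a) \<le> dist a y"
  using metric_proj_closest by auto

lemma dist_metric_proj: "dist a (metric_proj K a) = infdist a K"
  using closest_point_exists_Hilbert[OF K, of a] dist_metric_proj_le[of _ a]
    infdist_le[OF metric_proj_in, of a a] by force

lemma metric_proj_dot: "y \<in> K \<Longrightarrow> (a - metric_proj K a) \<bullet> (y - metric_proj K a) \<le> 0"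
  using any_closest_point_dot[OF K(2,1)] metric_proj_closest by blast

end

text \<open>Replaces the weak compactness argument: along \<open>K\<close> the distances from \<open>a\<close> increase to the
  distance from the intersection, which forces \<open>dist a (x k)\<close> to the maximal value that the
  obtuse angle condition permits.\<close>

lemma nested_convex_obtuse_tendsto_metric_proj:
  fixes K :: "nat \<Rightarrow> 'a::{real_inner, banach} set"
  assumes dec: "decseq K" and cl: "\<And>n. closed (K n)" and conv: "\<And>n. convex (K n)"
    and ne: "(\<Inter>n. K n) \<noteq> {}"
    and ev: "\<And>n. \<forall>\<^sub>F k in sequentially. x k \<in> K n"
    and obtuse: "\<And>k. (metric_proj (\<Inter>n. K n) a - x k) \<bullet> (a - x k) \<le> 0"
  shows "x \<longlonglongrightarrow> metric_proj (\<Inter>n. K n) a"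
proof -
  let ?S = "\<Inter>n. K n"
  define s where "s = metric_proj ?S a"
  have S: "closed ?S" "convex ?S" using cl conv by (auto intro: convex_INT)
  have sS: "s \<in> ?S" unfolding s_def by (rule metric_proj_in[OF S ne])
  have Kne: "K n \<noteq> {}" for n using ne by auto
  note K = cl conv Kne
  let ?r = "\<lambda>n. infdist a (K n)"
  have r_le: "?r n \<le> dist a s" for n using sS by (intro infdist_le) auto
  have "incseq ?r"
    using dec Kne by (intro monoI infdist_mono) (auto simp: decseq_def)
  then obtain d where d: "?r \<longlonglongrightarrow> d" using incseq_convergent r_le by blast
  define y where "y n = metric_proj (K n) a" for n
  have y: "y n \<in> K n" "dist a (y n) = ?r n" for n
    unfolding y_def by (rule metric_proj_in[OF K]) (rule dist_metric_proj[OF K])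
  \<comment> \<open>The projections of \<open>a\<close> onto the sets \<open>K n\<close> converge;
    their limit lies in every \<open>K n\<close> at distance d from \<open>a\<close>, so the
    intersection is no farther away than d.\<close>
  have "Cauchy y"
    by (rule nested_convex_minimizing_Cauchy[where K = K, OF dec conv y(1) _ d]) (simp add: y(2) d)
  then obtain q where q: "y \<longlonglongrightarrow> q" using Cauchy_convergent convergent_def by blast
  have "q \<in> K n" for n
  proof (rule Lim_in_closed_set[OF cl _ _ q])
    show "\<forall>\<^sub>F m in sequentially. y m \<in> K n"
      using y(1) decseqD[OF dec] unfolding eventually_sequentially by blast
  qed simp
  moreover have "dist a q = d"
    by (rule LIMSEQ_unique[OF tendsto_dist[OF tendsto_const q]]) (simp add: y(2) d)
  ultimately have "dist a s \<le> d"
    using dist_metric_proj_le[OF S ne, of q a] by (auto simp: s_def)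
  moreover have "d \<le> dist a s" by (rule LIMSEQ_le_const2[OF d]) (use r_le in auto)
  ultimately have ds: "d = dist a s" by simp
  \<comment> \<open>Expanding squares turns the angle condition at \<open>x k\<close> into a
    Pythagorean inequality.\<close>
  have pyth: "(dist (x k) s)\<^sup>2 \<le> d\<^sup>2 - (dist a (x k))\<^sup>2" for k
    using obtuse[of k]
    by (simp add: ds s_def dist_norm power2_norm_eq_inner inner_diff inner_commute algebra_simps)
  \<comment> \<open>From below, \<open>x k\<close> eventually lies in some \<open>K n\<close> whose
    distance from \<open>a\<close> exceeds c; from above, \<open>pyth\<close> keeps the distance
    within d.\<close>
  have "(\<lambda>k. dist a (x k)) \<longlonglongrightarrow> d"
  proof (rule order_tendstoI)
    fix c assume "c < d"
    then obtain n where "c < ?r n"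
      using order_tendstoD(1)[OF d] by (meson eventually_happens' sequentially_bot)
    with ev[of n] show "\<forall>\<^sub>F k in sequentially. c < dist a (x k)"
      by (elim eventually_mono) (meson less_le_trans infdist_le)
  next
    fix c assume "d < c"
    have "dist a (x k) \<le> d" for k
    proof (rule power2_le_imp_le)
      show "(dist a (x k))\<^sup>2 \<le> d\<^sup>2" using pyth[of k] by (smt (verit) zero_le_power2)
    qed (simp add: ds)
    then show "\<forall>\<^sub>F k in sequentially. dist a (x k) < c"
      using \<open>d < c\<close> by (intro always_eventually allI) (metis le_less_trans)
  qed
  then have "(\<lambda>k. d\<^sup>2 - (dist a (x k))\<^sup>2) \<longlonglongrightarrow> d\<^sup>2 - d\<^sup>2" by (intro tendsto_intros)
  then have lim: "(\<lambda>k. d\<^sup>2 - (dist a (x k))\<^sup>2) \<longlonglongrightarrow> 0" by simp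
  have "(\<lambda>k. (dist (x k) s)\<^sup>2) \<longlonglongrightarrow> 0"
    by (rule tendsto_sandwich[OF _ _ tendsto_const lim]) (simp_all add: pyth)
  then have "(\<lambda>k. dist (x k) s) \<longlonglongrightarrow> 0" by simp
  then show ?thesis unfolding s_def using tendsto_dist_iff by blast
qed

section \<open>Convex Gateaux differentiable functions\<close>

context
  fixes f :: "'a::real_inner \<Rightarrow> real"
  assumes convf: "convex_on UNIV f" and diff: "gateaux_differentiable f"
begin

text \<open>By convexity every difference quotient towards v with 0 < t < 1 is at most
  \<open>f v - f u\<close>, and so is its limit.\<close>

lemma gateaux_gradient_inequality: "f u + gateaux_gradient f u \<bullet> (v - u) \<le> f v"
proof -
  have "has_gateaux_gradient f u (gateaux_gradient f u)"
    using diff gateaux_gradient_eqI unfolding gateaux_differentiable_def by metis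
  then have "((\<lambda>t. (f (u + t *\<^sub>R (v - u)) - f u) / t)
      \<longlongrightarrow> gateaux_gradient f u \<bullet> (v - u)) (at_right 0)"
    unfolding has_gateaux_gradient_def has_directional_derivative_def by blast
  moreover have "\<forall>\<^sub>F t in at_right (0::real). (f (u + t *\<^sub>R (v - u)) - f u) / t \<le> f v - f u"
    unfolding eventually_at_right_field
  proof (intro exI[of _ 1] conjI allI impI)
    fix t :: real assume t: "0 < t" "t < 1"
    have "f ((1 - t) *\<^sub>R u + t *\<^sub>R v) \<le> (1 - t) * f u + t * f v"
      using convex_onD[OF convf] t by simp
    moreover have "(1 - t) *\<^sub>R u + t *\<^sub>R v = u + t *\<^sub>R (v - u)" by (simp add: algebra_simps)
    ultimately show "(f (u + t *\<^sub>R (v - u)) - f u) / t \<le> f v - f u"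
      using t by (simp add: divide_simps algebra_simps)
  qed simp
  ultimately have "gateaux_gradient f u \<bullet> (v - u) \<le> f v - f u"
    by (rule tendsto_upperbound) simp
  then show ?thesis by simp
qed

text \<open>Gateaux differentiability does not by itself give continuity, so closedness of sublevel
  sets is read off from tangent half-spaces; the one with u = v already forces
  \<open>f v \<le> c\<close>.\<close>

lemma sublevel_eq_Inter_halfspaces:
  "{v. f v \<le> c}
    = (\<Inter>u. {v. gateaux_gradient f u \<bullet> v \<le> c - f u + gateaux_gradient f u \<bullet> u})"
proof safe
  fix u v assume "f v \<le> c"
  then show "gateaux_gradient f u \<bullet> v \<le> c - f u + gateaux_gradient f u \<bullet> u"
    using gateaux_gradient_inequality[of u v] by (simp add: inner_diff_right)
next
  fix v assume "v \<in> (\<Inter>u. {v. gateaux_gradient f u \<bullet> v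
      \<le> c - f u + gateaux_gradient f u \<bullet> u})"
  then have "gateaux_gradient f v \<bullet> v \<le> c - f v + gateaux_gradient f v \<bullet> v" by blast
  then show "f v \<le> c" by simp
qed

lemma closed_sublevel: "closed {v. f v \<le> c}"
  unfolding sublevel_eq_Inter_halfspaces by (intro closed_INT ballI closed_halfspace_le)

lemma convex_sublevel_gateaux: "convex {v. f v \<le> c}"
  unfolding sublevel_eq_Inter_halfspaces by (intro convex_INT convex_halfspace_le)

text \<open>The gradient inequality is used at the trial point, so the decrease is at least t times
  \<open>?g ?v \<bullet> (u - p)\<close>; by Cauchy-Schwarz, \<open>small\<close> makes this inner
  product at least \<delta> times the one at u.\<close>

lemma sufficient_decrease:
  assumes t: "0 \<le> t"
    and small: "norm (gateaux_gradient f (t *\<^sub>R p + (1 - t) *\<^sub>R u) - gateaux_gradient f u) * norm (u - p)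
      \<le> (1 - \<delta>) * (gateaux_gradient f u \<bullet> (u - p))"
  shows "f (t *\<^sub>R p + (1 - t) *\<^sub>R u) \<le> f u - \<delta> * t * (gateaux_gradient f u \<bullet> (u - p))"
proof -
  let ?g = "gateaux_gradient f" and ?v = "t *\<^sub>R p + (1 - t) *\<^sub>R u"
  have "u - ?v = t *\<^sub>R (u - p)" by (simp add: algebra_simps)
  then have "f ?v \<le> f u - t * (?g ?v \<bullet> (u - p))"
    using gateaux_gradient_inequality[of ?v u] by simp
  also have "\<dots> \<le> f u - t * (\<delta> * (?g u \<bullet> (u - p)))"
  proof -
    have "(?g u - ?g ?v) \<bullet> (u - p) \<le> norm (?g u - ?g ?v) * norm (u - p)"
      by (rule norm_cauchy_schwarz)
    also have "\<dots> \<le> (1 - \<delta>) * (?g u \<bullet> (u - p))" using small by (simp add: norm_minus_commute)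
    finally have "\<delta> * (?g u \<bullet> (u - p)) \<le> ?g ?v \<bullet> (u - p)"
      by (simp add: inner_diff_left algebra_simps)
    then show ?thesis using t by (simp add: mult_left_mono)
  qed
  finally show ?thesis by (simp add: algebra_simps)
qed

end

section \<open>Runs of the algorithm\<close>

locale A2_run =
  fixes C :: "'a::{real_inner, banach} set" and f :: "'a \<Rightarrow> real"
    and \<theta> \<delta> \<beta>lo \<beta>hi :: real and \<beta> :: "nat \<Rightarrow> real" and x :: "nat \<Rightarrow> 'a"
  assumes C: "closed C" "convex C"
    and convf: "convex_on UNIV f" and diff: "gateaux_differentiable f"
    and sol_ne: "solution_set C f \<noteq> {}"
    and ucont: "bounded B \<Longrightarrow> uniformly_continuous_on B (gateaux_gradient f)"
    and bdd: "bounded B \<Longrightarrow> bounded (gateaux_gradient f ` B)"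
    and \<theta>: "0 < \<theta>" "\<theta> < 1" and \<delta>: "0 < \<delta>" "\<delta> < 1"
    and \<beta>: "0 < \<beta>lo" "\<And>k. \<beta>lo \<le> \<beta> k" "\<And>k. \<beta> k \<le> \<beta>hi"
    and gen: "generated_by_A2 C f \<theta> \<delta> \<beta> x"
begin

abbreviation "g \<equiv> gateaux_gradient f"
abbreviation "S \<equiv> solution_set C f"

definition p where "p k = grad_proj C f (\<beta> k) (x k)"
text \<open>The negative of the slope of f at \<open>x k\<close> in the direction
  \<open>p k - x k\<close>; the line search demands the fraction \<delta> of this first-order
  decrease.\<close>

definition D where "D k = g (x k) \<bullet> (x k - p k)"
definition trial where "trial k = trial_point C f \<theta> (\<beta> k) (x k)"
definition ls where "ls k = search_index C f \<theta> \<delta> (\<beta> k) (x k)"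
text \<open>Undoes the index shift of \<open>flev\<close>: this is the level after the k-th line
  search, finite because only the initial level is infinite.\<close>

definition lev where "lev k = real_of_ereal (flev C f \<theta> \<delta> \<beta> x (Suc k))"
definition Q where "Q k = C \<inter> W_set x k \<inter> H_set C f \<theta> \<delta> \<beta> x k"

lemmas grad_ineq = gateaux_gradient_inequality[OF convf diff]

lemma x0_in: "x 0 \<in> C" and x_neq_p: "x k \<noteq> p k" and x_Suc: "x (Suc k) = metric_proj (Q k) (x 0)"
  using gen unfolding generated_by_A2_def p_def Q_def by auto

lemma C_ne: "C \<noteq> {}" using x0_in by blast

lemma \<beta>_pos: "0 < \<beta> k" using \<beta>(1) \<beta>(2)[of k] by simp

lemma trial_eq: "trial k j = \<theta> ^ j *\<^sub>R p k + (1 - \<theta> ^ j) *\<^sub>R x k"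
  unfolding trial_def trial_point_def p_def by simp

lemma \<theta>_pow: "0 < \<theta> ^ j" "\<theta> ^ j \<le> 1"
  using \<theta> by (auto intro: power_le_one)

lemma p_in: "p k \<in> C"
  unfolding p_def grad_proj_def by (rule metric_proj_in[OF C C_ne])

lemma trial_in: "x k \<in> C \<Longrightarrow> trial k j \<in> C"
  unfolding trial_eq using \<theta>_pow[of j] p_in by (intro convexD[OF C(2)]) auto

text \<open>The variational inequality for the projected gradient step. Tested at \<open>x k\<close>
  it bounds the residual \<open>x k - p k\<close>, tested at a solution the optimality gap.\<close>

lemma p_dot: "y \<in> C \<Longrightarrow> (x k - p k) \<bullet> (y - p k) \<le> \<beta> k * (g (x k) \<bullet> (y - p k))"
  using metric_proj_dot[OF C C_ne, of y "x k - \<beta> k *\<^sub>R g (x k)"]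
  unfolding p_def grad_proj_def by (simp add: inner_diff_left)

section \<open>Level values, feasibility of the iterates and solutions inside
  \<open>Q k\<close>\<close>

lemma flev_Suc: "flev C f \<theta> \<delta> \<beta> x (Suc k) = ereal (lev k)"
proof -
  have "\<exists>r. flev C f \<theta> \<delta> \<beta> x (Suc k) = ereal r"
  proof (induction k)
    case (Suc k)
    then show ?case by (metis ereal_min flev.simps(2))
  qed simp
  then show ?thesis unfolding lev_def by auto
qed

lemma lev_0: "lev 0 = f (trial 0 (ls 0))"
  using flev_Suc[of 0] by (simp add: trial_def ls_def)

lemma lev_Suc: "lev (Suc k) = min (lev k) (f (trial (Suc k) (ls (Suc k))))"
proof -
  have "ereal (lev (Suc k)) = ereal (min (lev k) (f (trial (Suc k) (ls (Suc k)))))"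
    unfolding flev_Suc[symmetric] flev.simps(2)[of _ _ _ _ _ _ "Suc k"]
    unfolding flev_Suc trial_def ls_def by simp
  then show ?thesis by (simp only: ereal.inject)
qed

lemma lev_le: "lev k \<le> f (trial k (ls k))"
  by (cases k) (auto simp: lev_0 lev_Suc)

text \<open>Levels are minima of values of f at trial points, which are feasible by convexity.
  Feasibility of the iterates is a premise because \<open>iterates\<close> establishes it in the
  same induction that uses this bound.\<close>

lemma lev_ge:
  assumes "s \<in> S" "\<And>i. i \<le> k \<Longrightarrow> x i \<in> C"
  shows "f s \<le> lev k"
  using assms(2)
proof (induction k)
  case 0
  then show ?case using assms(1) trial_in by (auto simp: lev_0 solution_set_def)
next
  case (Suc k)
  then show ?case using assms(1) trial_in by (auto simp: lev_Suc solution_set_def)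
qed

lemma H_set_eq: "H_set C f \<theta> \<delta> \<beta> x k = {y. g (x k) \<bullet> y \<le> lev k - f (x k) + g (x k) \<bullet> x k}"
  unfolding H_set_def flev_Suc by (auto simp: inner_diff_right)

lemma W_set_eq: "W_set x k = {y. (x 0 - x k) \<bullet> y \<le> (x 0 - x k) \<bullet> x k}"
  unfolding W_set_def by (auto simp: inner_diff inner_commute)

lemma Q: "closed (Q k)" "convex (Q k)"
  unfolding Q_def H_set_eq W_set_eq
  by (intro closed_Int convex_Int C closed_halfspace_le convex_halfspace_le)+

text \<open>A joint induction: a solution in \<open>Q k\<close> makes the projection defining the
  next iterate meaningful, hence feasible, and feasibility up to \<open>Suc k\<close> puts the
  solutions into the next \<open>H_set\<close> via \<open>lev_ge\<close>.\<close>

lemma iterates: "(\<forall>i\<le>k. x i \<in> C) \<and> S \<subseteq> Q k"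
proof (induction k)
  have SH: "S \<subseteq> H_set C f \<theta> \<delta> \<beta> x k" if "\<forall>i\<le>k. x i \<in> C" for k
  proof
    fix s assume "s \<in> S"
    then have "f s \<le> lev k" using lev_ge that by blast
    then show "s \<in> H_set C f \<theta> \<delta> \<beta> x k"
      using grad_ineq[of "x k" s] by (simp add: H_set_eq inner_diff_right)
  qed
  have SC: "S \<subseteq> C" by (auto simp: solution_set_def)
  {
    case 0
    \<comment> \<open>The normal \<open>x 0 - x 0\<close> vanishes, so this set is the whole
      space.\<close>
    have "S \<subseteq> W_set x 0" by (simp add: W_set_eq)
    then show ?case using SH[of 0] SC x0_in by (auto simp: Q_def)
  next
    case (Suc k)
    have ne: "Q k \<noteq> {}" using Suc sol_ne by blast
    have "x (Suc k) \<in> C"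
      using metric_proj_in[OF Q ne] unfolding x_Suc by (auto simp: Q_def)
    then have all: "\<forall>i\<le>Suc k. x i \<in> C" using Suc by (auto simp: le_Suc_eq)
    \<comment> \<open>This is the variational inequality for the projection of \<open>x 0\<close>
      onto \<open>Q k\<close>, tested at the solutions.\<close>
    have "S \<subseteq> W_set x (Suc k)"
      using Suc metric_proj_dot[OF Q ne, of _ "x 0"]
      unfolding x_Suc W_set_def by (auto simp: inner_commute)
    then show ?case using all SH[OF all] SC by (auto simp: Q_def)
  }
qed

lemma x_in: "x k \<in> C" and S_sub_Q: "S \<subseteq> Q k"
  using iterates[of k] by auto

lemma Q_ne: "Q k \<noteq> {}"
  using S_sub_Q sol_ne by blast

section \<open>Monotone distances from the starting point and vanishing steps\<close>

lemma S_obtuse: "s \<in> S \<Longrightarrow> (s - x k) \<bullet> (x 0 - x k) \<le> 0"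
  using S_sub_Q[of k] by (auto simp: Q_def W_set_def)

lemma x_Suc_in: "x (Suc k) \<in> Q k"
  unfolding x_Suc by (rule metric_proj_in[OF Q Q_ne])

text \<open>The next iterate lies in \<open>W_set x k\<close>, so the triangle of
  \<open>x 0\<close>, \<open>x k\<close> and \<open>x (Suc k)\<close> has no acute angle at
  \<open>x k\<close>.\<close>

lemma norm_sq_step: "(norm (x (Suc k) - x k))\<^sup>2
    \<le> (norm (x (Suc k) - x 0))\<^sup>2 - (norm (x k - x 0))\<^sup>2"
proof -
  have "(x (Suc k) - x k) \<bullet> (x 0 - x k) \<le> 0" using x_Suc_in[of k] by (auto simp: Q_def W_set_def)
  then show ?thesis by (simp add: power2_norm_eq_inner inner_diff inner_commute algebra_simps)
qed

lemma norm_le_solution: "s \<in> S \<Longrightarrow> norm (x k - x 0) \<le> norm (s - x 0)"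
proof (cases k)
  case (Suc n)
  assume "s \<in> S"
  then show ?thesis
    using dist_metric_proj_le[OF Q Q_ne, of s n "x 0"] S_sub_Q
    unfolding Suc x_Suc by (auto simp: dist_norm norm_minus_commute)
qed simp

text \<open>The squared distances from \<open>x 0\<close> increase and are bounded, so their
  increments, which dominate the squared steps, tend to 0.\<close>

lemma steps_tendsto_0: "(\<lambda>k. norm (x (Suc k) - x k)) \<longlonglongrightarrow> 0"
proof -
  let ?a = "\<lambda>k. (norm (x k - x 0))\<^sup>2"
  obtain s where s: "s \<in> S" using sol_ne by blast
  have "?a k \<le> (norm (s - x 0))\<^sup>2" for k by (intro power_mono norm_le_solution[OF s]) simp
  moreover have "incseq ?a"
    using norm_sq_step by (intro incseq_SucI) (smt (verit) zero_le_power2)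
  ultimately obtain d where d: "?a \<longlonglongrightarrow> d" using incseq_convergent by blast
  have "(\<lambda>k. ?a (Suc k) - ?a k) \<longlonglongrightarrow> d - d" by (intro tendsto_diff LIMSEQ_Suc d)
  then have lim: "(\<lambda>k. ?a (Suc k) - ?a k) \<longlonglongrightarrow> 0" by simp
  have "(\<lambda>k. (norm (x (Suc k) - x k))\<^sup>2) \<longlonglongrightarrow> 0"
    by (rule tendsto_sandwich[OF _ _ tendsto_const lim]) (simp_all add: norm_sq_step)
  then show ?thesis by simp
qed

section \<open>Boundedness of iterates, gradients, residuals and trial points\<close>

lemma bounded_x: "bounded (range x)"
proof -
  obtain s where s: "s \<in> S" using sol_ne by blast
  show ?thesis
    using norm_le_solution[OF s]
    by (intro boundedI[of _ "norm (s - x 0) + norm (x 0)"])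
      (smt (verit) imageE norm_triangle_sub)
qed

lemma residual_sq_le: "(norm (x k - p k))\<^sup>2 \<le> \<beta> k * D k"
  using p_dot[OF x_in, of k k] by (simp add: D_def power2_norm_eq_inner)

lemma D_pos: "0 < D k"
proof -
  have "0 < \<beta> k * D k"
    using residual_sq_le[of k] x_neq_p[of k] by (smt (verit) right_minus_eq zero_less_norm_iff zero_less_power)
  then show ?thesis using \<beta>_pos[of k] by (simp add: zero_less_mult_iff)
qed

text \<open>Uniform continuity of the gradient is available on bounded sets, so one ball has to
  contain all iterates and all trial points.\<close>

lemma bounds:
  obtains G M R where "G > 0" "M > 0" "\<And>k. norm (g (x k)) \<le> G" "\<And>k. norm (x k - p k) \<le> M"
    "\<And>k j. trial k j \<in> cball 0 R" "\<And>k. x k \<in> cball 0 R"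
proof -
  obtain G where G: "G > 0" "\<And>k. norm (g (x k)) \<le> G"
    using bdd[OF bounded_x] unfolding bounded_pos by auto
  obtain R where R: "\<And>k. norm (x k) \<le> R"
    using bounded_x unfolding bounded_pos by auto
  have hi: "0 < \<beta>hi" using \<beta>_pos[of 0] \<beta>(3)[of 0] by simp
  have r: "norm (x k - p k) \<le> \<beta>hi * G" for k
  proof -
    let ?n = "norm (x k - p k)"
    have "?n * ?n \<le> \<beta> k * D k" using residual_sq_le[of k] by (simp add: power2_eq_square)
    also have "\<dots> \<le> \<beta>hi * (G * ?n)"
    proof (rule mult_mono[OF \<beta>(3)])
      have "D k \<le> norm (g (x k)) * ?n" unfolding D_def by (rule norm_cauchy_schwarz)
      also have "\<dots> \<le> G * ?n" using G(2) by (simp add: mult_right_mono)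
      finally show "D k \<le> G * ?n" .
    qed (use hi D_pos[of k] in auto)
    finally have "?n * ?n \<le> (\<beta>hi * G) * ?n" by simp
    \<comment> \<open>The failed stopping test makes the residual nonzero, so one factor
      cancels.\<close>
    then show ?thesis using x_neq_p[of k] by simp
  qed
  have "norm (trial k j) \<le> R + \<beta>hi * G" for k j
  proof -
    have "norm (p k) \<le> norm (x k) + norm (x k - p k)"
      by (metis norm_minus_commute norm_triangle_sub)
    then have "p k \<in> cball 0 (R + \<beta>hi * G)" "x k \<in> cball 0 (R + \<beta>hi * G)"
      using r[of k] R[of k] norm_ge_zero[of "x k - p k"] by (auto simp del: norm_ge_zero)
    then have "trial k j \<in> cball 0 (R + \<beta>hi * G)"
      unfolding trial_eq using \<theta>_pow[of j] by (intro convexD[OF convex_cball]) auto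
    then show ?thesis by simp
  qed
  moreover have "norm (x k) \<le> R + \<beta>hi * G" for k
    using R[of k] G hi by (smt (verit) mult_pos_pos)
  ultimately show ?thesis using that[OF G(1) _ G(2) r] G hi by auto
qed

section \<open>The line search\<close>

text \<open>The trial point lies at distance \<open>\<theta> ^ j\<close> times the residual from
  \<open>x k\<close>. The threshold \<eta> serves all k at once, which later bounds accepted steps
  from below while \<open>D k\<close> is not small.\<close>

lemma gradient_close:
  assumes "\<epsilon> > 0"
  obtains \<eta> where "\<eta> > 0" "\<And>k j. \<theta> ^ j \<le> \<eta> \<Longrightarrow> norm (g (trial k j) - g (x k)) * norm (x k - p k) \<le> \<epsilon>"
proof -
  obtain G M R where b: "M > 0" "\<And>k. norm (x k - p k) \<le> M"
    "\<And>k j. trial k j \<in> cball 0 R" "\<And>k. x k \<in> cball 0 R"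
    using bounds by metis
  have "\<epsilon> / M > 0" using assms b by simp
  then obtain d where d: "d > 0"
    "\<And>u v. u \<in> cball 0 R \<Longrightarrow> v \<in> cball 0 R \<Longrightarrow> dist v u < d \<Longrightarrow> dist (g v) (g u) < \<epsilon> / M"
    using ucont[OF bounded_cball, of 0 R] unfolding uniformly_continuous_on_def by metis
  show ?thesis
  \<comment> \<open>The factor 2 yields the strict inequality that uniform continuity asks
    for.\<close>
  proof (rule that[of "d / (2 * M)"])
    show "d / (2 * M) > 0" using d b by simp
    fix k j assume j: "\<theta> ^ j \<le> d / (2 * M)"
    have "trial k j - x k = \<theta> ^ j *\<^sub>R (p k - x k)" unfolding trial_eq by (simp add: algebra_simps)
    then have "dist (trial k j) (x k) = \<theta> ^ j * norm (x k - p k)"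
      using \<theta>_pow(1)[of j] by (simp add: dist_norm norm_minus_commute del: zero_less_power)
    also have "\<dots> \<le> d / (2 * M) * M" using j b d \<theta>_pow(1)[of j] by (intro mult_mono) auto
    also have "\<dots> < d" using b d by simp
    finally have "dist (g (trial k j)) (g (x k)) < \<epsilon> / M" using d b by blast
    then have "norm (g (trial k j) - g (x k)) * norm (x k - p k) \<le> \<epsilon> / M * M"
      unfolding dist_norm using b \<open>\<epsilon> / M > 0\<close> by (intro mult_mono) auto
    then show "norm (g (trial k j) - g (x k)) * norm (x k - p k) \<le> \<epsilon>" using b(1) by simp
  qed
qed

lemma trial_decrease:
  assumes "norm (g (trial k j) - g (x k)) * norm (x k - p k) \<le> (1 - \<delta>) * D k"
  shows "f (trial k j) \<le> f (x k) - \<delta> * \<theta> ^ j * D k"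
  using sufficient_decrease[OF convf diff, of "\<theta> ^ j" "p k" "x k" \<delta>] assms \<theta>_pow[of j]
  unfolding trial_eq D_def by simp

lemma ls_Least: "ls k = (LEAST j. f (trial k j) \<le> f (x k) - \<delta> * \<theta> ^ j * D k)"
  unfolding ls_def search_index_def trial_def D_def p_def ..

text \<open>The line search terminates: \<open>\<theta> ^ j\<close> tends to 0, so
  \<open>gradient_close\<close> with tolerance \<open>(1 - \<delta>) * D k\<close> provides an index
  passing the test.\<close>

lemma ls_decrease: "f (trial k (ls k)) \<le> f (x k) - \<delta> * \<theta> ^ ls k * D k"
proof -
  have "(1 - \<delta>) * D k > 0" using \<delta> D_pos by simp
  then obtain \<eta> where \<eta>: "\<eta> > 0"
    "\<And>i j. \<theta> ^ j \<le> \<eta> \<Longrightarrow> norm (g (trial i j) - g (x i)) * norm (x i - p i) \<le> (1 - \<delta>) * D k"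
    using gradient_close by metis
  obtain j where "\<theta> ^ j < \<eta>" using real_arch_pow_inv[OF \<eta>(1) \<theta>(2)] by blast
  then have "f (trial k j) \<le> f (x k) - \<delta> * \<theta> ^ j * D k" using \<eta>(2) by (intro trial_decrease) auto
  then show ?thesis unfolding ls_Least by (rule LeastI)
qed

text \<open>Index j was rejected, so the sufficient condition in \<open>trial_decrease\<close> must
  fail there.\<close>

lemma ls_pred:
  assumes "ls k = Suc j"
  shows "(1 - \<delta>) * D k < norm (g (trial k j) - g (x k)) * norm (x k - p k)"
proof (rule ccontr)
  assume "\<not> ?thesis"
  then have "f (trial k j) \<le> f (x k) - \<delta> * \<theta> ^ j * D k" by (intro trial_decrease) simp
  then have "ls k \<le> j" unfolding ls_Least by (rule Least_le)
  then show False using assms by simp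
qed

section \<open>Vanishing decrease and convergence of the function values\<close>

lemma step_D_tendsto_0: "(\<lambda>k. \<theta> ^ ls k * D k) \<longlonglongrightarrow> 0"
proof -
  obtain G where G: "G > 0" "\<And>k. norm (g (x k)) \<le> G" using bounds by metis
  have le: "\<theta> ^ ls k * D k \<le> G / \<delta> * norm (x (Suc k) - x k)" for k
  proof -
    \<comment> \<open>Membership in \<open>H_set\<close> bounds the drop from \<open>f (x k)\<close>
      to the level by the gradient norm times the step length, and the line search makes this drop
      at least \<open>\<delta> * \<theta> ^ ls k * D k\<close>.\<close>
    have "g (x k) \<bullet> (x (Suc k) - x k) + f (x k) \<le> lev k"
      using x_Suc_in[of k] by (simp add: Q_def H_set_eq inner_diff_right)
    then have "\<delta> * (\<theta> ^ ls k * D k) \<le> g (x k) \<bullet> (x k - x (Suc k))"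
      using lev_le[of k] ls_decrease[of k] by (simp add: inner_diff_right)
    also have "\<dots> \<le> norm (g (x k)) * norm (x k - x (Suc k))" by (rule norm_cauchy_schwarz)
    also have "\<dots> \<le> G * norm (x (Suc k) - x k)"
      using G(2) by (simp add: norm_minus_commute mult_right_mono)
    finally show ?thesis using \<delta>(1) by (simp add: field_simps)
  qed
  have "(\<lambda>k. G / \<delta> * norm (x (Suc k) - x k)) \<longlonglongrightarrow> G / \<delta> * 0"
    by (intro tendsto_intros steps_tendsto_0)
  then have lim: "(\<lambda>k. G / \<delta> * norm (x (Suc k) - x k)) \<longlonglongrightarrow> 0" by simp
  show ?thesis
    by (rule tendsto_sandwich[OF _ _ tendsto_const lim])
      (use le D_pos \<theta> in \<open>auto intro!: always_eventually mult_nonneg_nonneg less_imp_le[OF D_pos]\<close>)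
qed

text \<open>Whenever \<open>D k\<close> is at least \<epsilon>, the accepted step is at least m, so
  the product in \<open>step_D_tendsto_0\<close> is at least \<open>m * \<epsilon>\<close>; this
  happens only finitely often.\<close>

lemma D_tendsto_0: "D \<longlonglongrightarrow> 0"
proof (rule order_tendstoI)
  fix \<epsilon> :: real assume \<epsilon>: "0 < \<epsilon>"
  then have "(1 - \<delta>) * \<epsilon> > 0" using \<delta> by simp
  then obtain \<eta> where \<eta>: "\<eta> > 0"
    "\<And>k j. \<theta> ^ j \<le> \<eta> \<Longrightarrow> norm (g (trial k j) - g (x k)) * norm (x k - p k) \<le> (1 - \<delta>) * \<epsilon>"
    using gradient_close by metis
  \<comment> \<open>The value 1 covers acceptance of index 0; otherwise the last rejected step,
    larger by one factor 1/\<theta>, exceeds \<eta>.\<close>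
  define m where "m = min 1 (\<theta> * \<eta>)"
  have m: "m > 0" unfolding m_def using \<theta> \<eta>(1) by simp
  have step_ge: "m \<le> \<theta> ^ ls k" if "\<epsilon> \<le> D k" for k
  proof (cases "ls k")
    case (Suc j)
    have "(1 - \<delta>) * \<epsilon> \<le> (1 - \<delta>) * D k" using that \<delta> by (intro mult_left_mono) auto
    then have "\<eta> < \<theta> ^ j" using ls_pred[OF Suc] \<eta>(2)[of j k] by linarith
    then have "\<theta> * \<eta> \<le> \<theta> ^ ls k" using Suc \<theta> by simp
    then show ?thesis by (simp add: m_def)
  qed (simp add: m_def)
  have "\<forall>\<^sub>F k in sequentially. \<theta> ^ ls k * D k < m * \<epsilon>"
    using order_tendstoD(2)[OF step_D_tendsto_0] m \<epsilon> by simp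
  then show "\<forall>\<^sub>F k in sequentially. D k < \<epsilon>"
  proof (rule eventually_mono)
    fix k assume "\<theta> ^ ls k * D k < m * \<epsilon>"
    then show "D k < \<epsilon>" using step_ge[of k] m \<epsilon> mult_mono[of m "\<theta> ^ ls k" \<epsilon> "D k"] by force
  qed
next
  fix a :: real assume "a < 0"
  then show "\<forall>\<^sub>F k in sequentially. a < D k"
    using D_pos by (intro always_eventually allI) (meson less_trans)
qed

lemma residual_tendsto_0: "(\<lambda>k. norm (x k - p k)) \<longlonglongrightarrow> 0"
proof -
  have "(\<lambda>k. \<beta>hi * D k) \<longlonglongrightarrow> \<beta>hi * 0" by (intro tendsto_intros D_tendsto_0)
  then have lim: "(\<lambda>k. \<beta>hi * D k) \<longlonglongrightarrow> 0" by simp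
  have le: "(norm (x k - p k))\<^sup>2 \<le> \<beta>hi * D k" for k
    by (rule order_trans[OF residual_sq_le mult_right_mono[OF \<beta>(3) less_imp_le[OF D_pos]]])
  have "(\<lambda>k. (norm (x k - p k))\<^sup>2) \<longlonglongrightarrow> 0"
    by (rule tendsto_sandwich[OF _ _ tendsto_const lim]) (use le in \<open>auto intro: always_eventually\<close>)
  then show ?thesis by simp
qed

text \<open>Splitting \<open>x k - s\<close> at \<open>p k\<close> bounds the optimality gap by
  \<open>D k\<close> plus a term that \<open>p_dot\<close>, tested at s, bounds by a multiple of the
  residual.\<close>

lemma f_tendsto_min:
  assumes "s \<in> S"
  shows "(\<lambda>k. f (x k)) \<longlonglongrightarrow> f s"
proof -
  obtain M R where b: "\<And>k. norm (x k - p k) \<le> M" "\<And>k. x k \<in> cball 0 R" using bounds by metis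
  \<comment> \<open>The numerator bounds the distance from \<open>p k\<close> to s; the denominator
    comes from dividing \<open>p_dot\<close> by the stepsize.\<close>
  define B where "B = (R + norm s + M) / \<beta>lo"
  have sC: "s \<in> C" "\<And>y. y \<in> C \<Longrightarrow> f s \<le> f y" using assms by (auto simp: solution_set_def)
  have le: "f (x k) \<le> f s + D k + norm (x k - p k) * B" for k
  proof -
    let ?n = "norm (x k - p k)"
    have n: "norm (p k - s) \<le> R + norm s + M"
    proof -
      have "norm (p k - s) \<le> norm (p k) + norm s" by (rule norm_triangle_ineq4)
      moreover have "norm (p k) \<le> norm (x k) + norm (x k - p k)"
        by (metis norm_minus_commute norm_triangle_sub)
      ultimately show ?thesis using b(1)[of k] b(2)[of k] by simp
    qed
    have "\<beta> k * (g (x k) \<bullet> (p k - s)) \<le> (x k - p k) \<bullet> (p k - s)"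
      using p_dot[OF sC(1), of k] by (simp add: inner_diff_right algebra_simps)
    also have "\<dots> \<le> ?n * norm (p k - s)" by (rule norm_cauchy_schwarz)
    also have "\<dots> \<le> ?n * (R + norm s + M)" using n by (simp add: mult_left_mono)
    finally have "g (x k) \<bullet> (p k - s) \<le> ?n * (R + norm s + M) / \<beta> k"
      using \<beta>_pos[of k] by (simp add: field_simps)
    also have "\<dots> \<le> ?n * (R + norm s + M) / \<beta>lo"
      using \<beta>(1) \<beta>(2)[of k] order_trans[OF norm_ge_zero n]
      by (intro divide_left_mono mult_nonneg_nonneg mult_pos_pos \<beta>_pos) auto
    finally have "g (x k) \<bullet> (p k - s) \<le> ?n * B" by (simp add: B_def)
    then show ?thesis
      using grad_ineq[of "x k" s] by (simp add: D_def inner_diff_right)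
  qed
  have "(\<lambda>k. f s + D k + norm (x k - p k) * B) \<longlonglongrightarrow> f s + 0 + 0 * B"
    by (intro tendsto_intros D_tendsto_0 residual_tendsto_0)
  then have lim: "(\<lambda>k. f s + D k + norm (x k - p k) * B) \<longlonglongrightarrow> f s" by simp
  show ?thesis
    by (rule tendsto_sandwich[OF _ _ tendsto_const lim])
      (use le sC(2)[OF x_in] in \<open>auto intro: always_eventually\<close>)
qed

lemma converges: "x \<longlonglongrightarrow> metric_proj S (x 0)"
proof -
  obtain s where s: "s \<in> S" using sol_ne by blast
  define K where "K n = C \<inter> {v. f v \<le> f s + 1 / real (Suc n)}" for n
  have SK: "(\<Inter>n. K n) = S"
  proof
    show "S \<subseteq> (\<Inter>n. K n)"
      using s by (auto simp: K_def solution_set_def intro: order_trans)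
    show "(\<Inter>n. K n) \<subseteq> S"
    proof
      fix v assume v: "v \<in> (\<Inter>n. K n)"
      have "(\<lambda>n. f s + 1 / real (Suc n)) \<longlonglongrightarrow> f s"
        using tendsto_add[OF tendsto_const LIMSEQ_Suc[OF lim_1_over_n]] by fastforce
      then have "f v \<le> f s" by (rule LIMSEQ_le_const) (use v in \<open>auto simp: K_def\<close>)
      then show "v \<in> S" using s v by (force simp: K_def solution_set_def)
    qed
  qed
  \<comment> \<open>Ensures that the projection onto \<open>S\<close> lies in \<open>S\<close>, so
    that \<open>S_obtuse\<close> applies to it.\<close>
  have S: "closed S" "convex S"
    unfolding SK[symmetric] K_def
    by (intro closed_INT convex_INT ballI closed_Int convex_Int C closed_sublevel[OF convf diff]
        convex_sublevel_gateaux[OF convf diff])+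
  have "x \<longlonglongrightarrow> metric_proj (\<Inter>n. K n) (x 0)"
  proof (rule nested_convex_obtuse_tendsto_metric_proj)
    show "decseq K"
      by (auto simp: decseq_def K_def intro: order_trans[OF _ add_left_mono[OF frac_le]])
    show "closed (K n)" "convex (K n)" for n
      unfolding K_def
      by (intro closed_Int convex_Int C closed_sublevel[OF convf diff]
          convex_sublevel_gateaux[OF convf diff])+
    show "\<forall>\<^sub>F k in sequentially. x k \<in> K n" for n
    proof -
      have "\<forall>\<^sub>F k in sequentially. f (x k) < f s + 1 / real (Suc n)"
        by (rule order_tendstoD(2)[OF f_tendsto_min[OF s]]) simp
      then show ?thesis by (rule eventually_mono) (use x_in in \<open>simp add: K_def less_imp_le\<close>)
    qed
    show "(metric_proj (\<Inter>n. K n) (x 0) - x k) \<bullet> (x 0 - x k) \<le> 0" for k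
      unfolding SK by (rule S_obtuse[OF metric_proj_in[OF S sol_ne]])
  qed (simp add: SK sol_ne)
  then show ?thesis unfolding SK .
qed

end

theorem theorem4p1:
  fixes C :: "'a::{real_inner, banach} set"
    and f :: "'a \<Rightarrow> real"
    and \<theta> \<delta> \<beta>lo \<beta>hi :: real
    and \<beta> :: "nat \<Rightarrow> real"
    and x :: "nat \<Rightarrow> 'a"
  assumes "C \<noteq> {}" and "closed C" and "convex C"
    and "convex_on UNIV f" and "gateaux_differentiable f"
    and "solution_set C f \<noteq> {}"
    and "\<And>B. bounded B \<Longrightarrow> uniformly_continuous_on B (gateaux_gradient f)"
    and "\<And>B. bounded B \<Longrightarrow> bounded (gateaux_gradient f ` B)"
    and "0 < \<theta>" and "\<theta> < 1" and "0 < \<delta>" and "\<delta> < 1"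
    and "0 < \<beta>lo" and "\<beta>lo \<le> \<beta>hi" and "\<And>k. \<beta> k \<in> {\<beta>lo..\<beta>hi}"
    and "generated_by_A2 C f \<theta> \<delta> \<beta> x"
  shows "x \<longlonglongrightarrow> metric_proj (solution_set C f) (x 0)"
proof -
  interpret A2_run C f \<theta> \<delta> \<beta>lo \<beta>hi \<beta> x
    using assms by unfold_locales auto
  show ?thesis by (rule converges)
qed

end
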